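(* For every $a\in(0,1/2]$ there exist constants $c_1,c_2>0$, depending only on $a$, such that for every $n\ge1$ and every event $\mathcal{A}\subset\Omega_n$ with $I\!I(\mathcal{A})\le n^{-a}$, $$\phi(\mathcal{A},\epsilon)\le c_1 n^{-c_2\epsilon}\qquad\text{for all }\epsilon\in(0,1/4).$$ Consequently, if $a\in(0,1/2]$, $\mathcal{A}_m\subset\Omega_{n_m}$ is a sequence of events satisfying $I\!I(\mathcal{A}_m)\le (n_m)^{-a}$ for all $m$, and $\epsilon_m$ is a sequence in $(0,1/4)$ such that $\epsilon_m\log n_m\to\infty$, then $\phi(\mathcal{A}_m,\epsilon_m)\to0$.
   Context: $\Omega_n=\{0,1\}^n$ carries the uniform probability measure $\mathbf{P}$; an event is a subset $\mathcal{A}\subset\Omega_n$. Influences: for $x\in\Omega_n$ and $j\in\{1,\dots,n\}$, $\sigma_jx$ is $x$ with the $j$-th coordinate replaced by $1-x_j$. For $f:\Omega_n\to\mathbb{R}$, $I_k(f)=\mathbf{E}|f(\sigma_kx)-f(x)|$ (with $x$ uniform), and $I\!I(f)=\sum_{k=1}^n I_k(f)^2$. For an event, $I\!I(\mathcal{A})=I\!I(\chi_{\mathcal{A}})$, where $\chi_{\mathcal{A}}$ is the indicator function. Noise: for $x\in\Omega_n$ and $\epsilon\in(0,1)$, $N_\epsilon(x)$ is the random element of $\Omega_n$ whose coordinates are, independently, $x_j$ with probability $1-\epsilon$ and $1-x_j$ with probability $\epsilon$. Sensitivity gauge: for an event $\mathcal{A}\subset\Omega_n$ and $\delta>0$, let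 $$\gamma(\mathcal{A},\epsilon,\delta)=\mathbf{P}\Bigl\{x\in\Omega_n:\bigl|\mathbf{P}(N_\epsilon(x)\in\mathcal{A}\mid x)-\mathbf{P}(\mathcal{A})\bigr|>\delta\Bigr\},\qquad \phi(\mathcal{A},\epsilon)=\inf\{\delta>0:\gamma(\mathcal{A},\epsilon,\delta)<\delta\}.$$ *)

theory Defs
  imports "HOL-Probability.Probability" "HOL-Probability.Product_PMF"
begin

text \<open>
  The dimension \<open>n\<close> is quantified inside the results, so the cube \<open>{0,1}\<^sup>n\<close> is not a type but a set of
  functions \<open>nat \<Rightarrow> bool\<close>: \<open>True\<close> and \<open>False\<close> stand for \<open>1\<close> and \<open>0\<close>, the coordinates are
  \<open>1, \<dots>, n\<close>, and the value at every other index is fixed to \<open>False\<close>, the convention of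
  \<open>Pi_pmf\<close>.
\<close>

definition cube :: "nat \<Rightarrow> (nat \<Rightarrow> bool) set" where
  "cube n = PiE_dflt {1..n} False (\<lambda>_. UNIV)"

definition unif :: "nat \<Rightarrow> (nat \<Rightarrow> bool) pmf" where
  "unif n = pmf_of_set (cube n)"

definition flip :: "nat \<Rightarrow> (nat \<Rightarrow> bool) \<Rightarrow> (nat \<Rightarrow> bool)" where
  "flip j x = x(j := \<not> x j)"

definition influence :: "nat \<Rightarrow> nat \<Rightarrow> ((nat \<Rightarrow> bool) \<Rightarrow> real) \<Rightarrow> real" where
  "influence n k f = measure_pmf.expectation (unif n) (\<lambda>x. \<bar>f (flip k x) - f x\<bar>)"

definition II :: "nat \<Rightarrow> ((nat \<Rightarrow> bool) \<Rightarrow> real) \<Rightarrow> real" where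
  "II n f = (\<Sum>k=1..n. (influence n k f)\<^sup>2)"

text \<open>The Bernoulli variable is the indicator that the coordinate is flipped.\<close>

definition noise :: "nat \<Rightarrow> real \<Rightarrow> (nat \<Rightarrow> bool) \<Rightarrow> (nat \<Rightarrow> bool) pmf" where
  "noise n \<epsilon> x =
     Pi_pmf {1..n} False (\<lambda>j. map_pmf (\<lambda>b. if b then \<not> x j else x j) (bernoulli_pmf \<epsilon>))"

definition sens_gamma :: "nat \<Rightarrow> (nat \<Rightarrow> bool) set \<Rightarrow> real \<Rightarrow> real \<Rightarrow> real" where
  "sens_gamma n A \<epsilon> \<delta> =
     measure_pmf.prob (unif n)
       {x \<in> cube n. \<bar>measure_pmf.prob (noise n \<epsilon> x) A - measure_pmf.prob (unif n) A\<bar> > \<delta>}"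

text \<open>The set below contains every \<open>\<delta> > 1\<close> and is bounded below by \<open>0\<close>, so the real infimum is the
  genuine one.\<close>

definition sens_phi :: "nat \<Rightarrow> (nat \<Rightarrow> bool) set \<Rightarrow> real \<Rightarrow> real" where
  "sens_phi n A \<epsilon> = Inf {\<delta>. \<delta> > 0 \<and> sens_gamma n A \<epsilon> \<delta> < \<delta>}"

end

theory Submission
  imports Defs
begin

text \<open>
  Put \<open>\<rho> = 1 - 2\<epsilon>\<close>. In the Walsh basis the noise operator multiplies the coefficient at \<open>S\<close> by
  \<open>\<rho>\<^bsup>|S|\<^esup>\<close>, so by Chebyshev's inequality everything reduces to a bound on
  \<open>V(\<rho>) = \<Sum>\<^bsub>S \<noteq> \<emptyset>\<^esub> \<rho>\<^bsup>2|S|\<^esup> f(S)\<^sup>2\<close>, where \<open>f(S)\<close> are the Walsh coefficients of the indicator of the event.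

  For \<open>r\<^sup>2 = 1/(2m - 1)\<close> the Bonami inequality \<open>\<parallel>T\<^sub>r g\<parallel>\<^bsub>2m\<^esub> \<le> \<parallel>g\<parallel>\<^sub>2\<close> has an elementary proof, since the exponent
  is an even integer: the two-point case compares binomial coefficients, and it tensorizes by
  Minkowski's inequality. Dually, the discrete derivative \<open>g\<close> in direction \<open>k\<close>, which takes values in
  \<open>{-1,0,1}\<close>, satisfies \<open>\<parallel>T\<^sub>r g\<parallel>\<^sub>2\<^sup>2 \<le> I\<^sub>k\<^bsup>2 - 1/m\<^esup>\<close>. Summing over \<open>k\<close> with Hoelder's inequality and
  \<open>\<Sum> I\<^sub>k\<^sup>2 \<le> n\<^bsup>-a\<^esup>\<close> gives \<open>V(r) \<le> n\<^bsup>-a/2\<^esup>\<close> as soon as \<open>2m \<ge> 3/a\<close>. Finally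
  \<open>V(\<rho>) \<le> V(r)\<^bsup>\<theta>\<^esup>\<close> with \<open>\<theta> = ln \<rho> / ln r \<ge> 2\<epsilon> / ln (1/r)\<close>, again by Hoelder's inequality.
\<close>

subsection \<open>Walsh functions\<close>

lemma sum_Pow_insert:
  fixes f :: "'a set \<Rightarrow> real"
  assumes "finite T" "k \<notin> T"
  shows "(\<Sum>X\<in>Pow (insert k T). f X) = (\<Sum>X\<in>Pow T. f X + f (insert k X))"
proof -
  have "Pow T \<inter> insert k ` Pow T = {}"
    using assms by auto
  moreover have "inj_on (insert k) (Pow T)"
    using assms by (auto simp: inj_on_def)
  ultimately show ?thesis
    using assms by (simp add: Pow_insert sum.union_disjoint sum.reindex sum.distrib)
qed

text \<open>A point of the cube is encoded as the set of its coordinates equal to 1. Characters and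
  points are then both subsets of the index set, and the formula is symmetric in them.\<close>

definition walsh :: "'a set \<Rightarrow> 'a set \<Rightarrow> real" where
  "walsh S X = (-1) ^ card (S \<inter> X)"

lemma walsh_commute: "walsh S X = walsh X S"
  by (simp add: walsh_def Int_commute)

lemma walsh_insert_left [simp]: "k \<notin> X \<Longrightarrow> walsh (insert k S) X = walsh S X"
  by (simp add: walsh_def)

lemma walsh_insert_right [simp]: "k \<notin> S \<Longrightarrow> walsh S (insert k X) = walsh S X"
  by (simp add: walsh_def)

lemma walsh_insert_both:
  "finite S \<Longrightarrow> k \<notin> S \<Longrightarrow> walsh (insert k S) (insert k X) = - walsh S X"
  by (simp add: walsh_def)

text \<open>Induction on \<open>I\<close>: pairing \<open>X\<close> with \<open>insert k X\<close>
  doubles the summand if \<open>S\<close> and \<open>T\<close> agree at \<open>k\<close> and cancels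
  it otherwise.\<close>

lemma walsh_orthogonal:
  assumes "finite I" "S \<subseteq> I" "T \<subseteq> I"
  shows "(\<Sum>X\<in>Pow I. walsh S X * walsh T X) = (if S = T then 2 ^ card I else 0)"
  using assms
proof (induction I arbitrary: S T rule: finite_induct)
  case empty
  then show ?case by (simp add: walsh_def)
next
  case (insert k I)
  define S' T' where "S' = S - {k}" and "T' = T - {k}"
  have sub: "S' \<subseteq> I" "T' \<subseteq> I" and fin: "finite S'" "finite T'" and nin: "k \<notin> S'" "k \<notin> T'"
    using insert.prems insert.hyps by (auto simp: S'_def T'_def intro: finite_subset)
  have eq: "S = (if k \<in> S then insert k S' else S')" "T = (if k \<in> T then insert k T' else T')"
    by (auto simp: S'_def T'_def)
  have *: "walsh S X * walsh T X + walsh S (insert k X) * walsh T (insert k X) =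
      (if (k \<in> S) = (k \<in> T) then 2 else 0) * (walsh S' X * walsh T' X)"
    if "X \<in> Pow I" for X
  proof -
    have kX: "k \<notin> X"
      using that insert.hyps by auto
    have "walsh R X = walsh R' X \<and> walsh R (insert k X) = (if k \<in> R then - walsh R' X else walsh R' X)"
      if "R = (if k \<in> R then insert k R' else R')" "k \<notin> R'" "finite R'" for R R'
      using that kX by (metis walsh_insert_left walsh_insert_right walsh_insert_both)
    note this[OF eq(1) nin(1) fin(1)] this[OF eq(2) nin(2) fin(2)]
    then show ?thesis by auto
  qed
  have iff: "S = T \<longleftrightarrow> ((k \<in> S) = (k \<in> T)) \<and> S' = T'"
    by (auto simp: S'_def T'_def)
  have "(\<Sum>X\<in>Pow (insert k I). walsh S X * walsh T X) =
      (if (k \<in> S) = (k \<in> T) then 2 else 0) * (\<Sum>X\<in>Pow I. walsh S' X * walsh T' X)"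
    by (simp only: sum_Pow_insert[OF insert.hyps] sum_distrib_left * cong: sum.cong)
  also have "\<dots> = (if S = T then 2 ^ card (insert k I) else 0)"
    using insert.IH[OF sub] insert.hyps unfolding iff by auto
  finally show ?case .
qed

section \<open>Walsh coefficients, inversion and Parseval\<close>

definition fcoeff :: "'a set \<Rightarrow> ('a set \<Rightarrow> real) \<Rightarrow> 'a set \<Rightarrow> real" where
  "fcoeff I f S = (\<Sum>X\<in>Pow I. f X * walsh S X) / 2 ^ card I"

text \<open>By \<open>walsh_commute\<close> points and characters can trade places, so orthogonality
  also holds for sums over characters.\<close>

lemma walsh_inversion:
  assumes "finite I" "Y \<subseteq> I"
  shows "f Y = (\<Sum>S\<in>Pow I. fcoeff I f S * walsh S Y)"
proof -
  have "(\<Sum>S\<in>Pow I. fcoeff I f S * walsh S Y) =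
      (\<Sum>S\<in>Pow I. \<Sum>X\<in>Pow I. f X * (walsh X S * walsh Y S)) / 2 ^ card I"
    by (simp add: fcoeff_def sum_divide_distrib sum_distrib_right walsh_commute mult.assoc)
  also have "\<dots> = (\<Sum>X\<in>Pow I. f X * (\<Sum>S\<in>Pow I. walsh X S * walsh Y S)) / 2 ^ card I"
    by (subst sum.swap) (simp add: sum_distrib_left)
  also have "\<dots> = (\<Sum>X\<in>Pow I. if X = Y then f X * 2 ^ card I else 0) / 2 ^ card I"
    using assms by (intro arg_cong2[where f = "(/)"] sum.cong refl) (auto simp: walsh_orthogonal)
  also have "\<dots> = f Y"
    using assms by simp
  finally show ?thesis by simp
qed

text \<open>Plancherel's identity with one factor given by its coefficients. It yields Parseval and
  the pairing in the duality argument.\<close>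

lemma sum_mult_walsh_expansion:
  "(\<Sum>X\<in>Pow I. f X * (\<Sum>S\<in>Pow I. c S * walsh S X)) = 2 ^ card I * (\<Sum>S\<in>Pow I. c S * fcoeff I f S)"
proof -
  have "(\<Sum>X\<in>Pow I. f X * (\<Sum>S\<in>Pow I. c S * walsh S X)) =
      (\<Sum>S\<in>Pow I. \<Sum>X\<in>Pow I. c S * (f X * walsh S X))"
    by (subst sum.swap) (simp add: sum_distrib_left mult_ac)
  also have "\<dots> = 2 ^ card I * (\<Sum>S\<in>Pow I. c S * fcoeff I f S)"
    unfolding fcoeff_def
    by (simp add: sum_distrib_left[symmetric] sum_divide_distrib[symmetric])
  finally show ?thesis .
qed

lemma fcoeff_walsh_expansion:
  assumes "finite I" "T \<subseteq> I"
  shows "fcoeff I (\<lambda>X. \<Sum>S\<in>Pow I. c S * walsh S X) T = c T"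
proof -
  have "(\<Sum>X\<in>Pow I. (\<Sum>S\<in>Pow I. c S * walsh S X) * walsh T X) =
      (\<Sum>S\<in>Pow I. c S * (\<Sum>X\<in>Pow I. walsh S X * walsh T X))"
    by (simp only: sum_distrib_right sum_distrib_left mult.assoc) (rule sum.swap)
  also have "\<dots> = (\<Sum>S\<in>Pow I. if S = T then c S * 2 ^ card I else 0)"
    using assms by (intro sum.cong refl) (auto simp: walsh_orthogonal)
  also have "\<dots> = c T * 2 ^ card I"
    using assms by simp
  finally show ?thesis by (simp add: fcoeff_def)
qed

lemma walsh_parseval:
  assumes "finite I"
  shows "(\<Sum>X\<in>Pow I. (\<Sum>S\<in>Pow I. c S * walsh S X)\<^sup>2) = 2 ^ card I * (\<Sum>S\<in>Pow I. (c S)\<^sup>2)"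
  unfolding power2_eq_square sum_mult_walsh_expansion
  using assms by (intro arg_cong2[where f = "(*)"] sum.cong refl) (simp add: fcoeff_walsh_expansion)

lemma parseval:
  assumes "finite I"
  shows "(\<Sum>X\<in>Pow I. (f X)\<^sup>2) = 2 ^ card I * (\<Sum>S\<in>Pow I. (fcoeff I f S)\<^sup>2)"
proof -
  have "(\<Sum>X\<in>Pow I. (f X)\<^sup>2) = (\<Sum>X\<in>Pow I. (\<Sum>S\<in>Pow I. fcoeff I f S * walsh S X)\<^sup>2)"
    using assms by (intro sum.cong refl) (simp add: walsh_inversion[symmetric])
  then show ?thesis using walsh_parseval[OF assms] by simp
qed

subsection \<open>Hypercontractivity\<close>

lemma convex_on_power_nonneg: "convex_on {0::real..} (\<lambda>x. x ^ m)"
proof (cases "even m")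
  case True
  then show ?thesis by (rule convex_on_subset[OF convex_power_even]) auto
qed (rule convex_power_odd)

text \<open>Minkowski's inequality without roots: \<open>\<alpha>\<close> and \<open>\<beta>\<close>
  stand for norm bounds and \<open>K\<close> for the total mass. It is convexity of the
  \<open>m\<close>-th power at the average of \<open>u x / \<alpha>\<close> and
  \<open>v x / \<beta>\<close> with weights proportional to \<open>\<alpha>\<close> and
  \<open>\<beta>\<close>.\<close>

lemma minkowski_power_sum:
  fixes u v :: "'b \<Rightarrow> real"
  assumes "finite A" "m \<ge> 1" "\<And>x. x \<in> A \<Longrightarrow> u x \<ge> 0" "\<And>x. x \<in> A \<Longrightarrow> v x \<ge> 0"
    and "\<alpha> \<ge> 0" "\<beta> \<ge> 0"
    and u: "(\<Sum>x\<in>A. u x ^ m) \<le> K * \<alpha> ^ m" and v: "(\<Sum>x\<in>A. v x ^ m) \<le> K * \<beta> ^ m"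
  shows "(\<Sum>x\<in>A. (u x + v x) ^ m) \<le> K * (\<alpha> + \<beta>) ^ m"
proof -
  \<comment> \<open>Covers a vanishing norm bound, where the normalization would divide by
    zero.\<close>
  have zero: "\<forall>x\<in>A. w x = 0" if "(\<Sum>x\<in>A. w x ^ m) \<le> K * 0 ^ m" "\<And>x. x \<in> A \<Longrightarrow> w x \<ge> 0" for w :: "'b \<Rightarrow> real"
  proof -
    have "(\<Sum>x\<in>A. w x ^ m) = 0"
      using that \<open>m \<ge> 1\<close> by (intro antisym sum_nonneg) (auto simp: power_0_left)
    then show ?thesis
      using that \<open>finite A\<close> by (subst (asm) sum_nonneg_eq_0_iff) auto
  qed
  consider "\<alpha> = 0" | "\<beta> = 0" | "\<alpha> > 0" "\<beta> > 0"
    using assms by linarith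
  then show ?thesis
  proof cases
    case 1
    then show ?thesis using zero[of u] u v assms(3) by simp
  next
    case 2
    then show ?thesis using zero[of v] u v assms(4) by simp
  next
    case 3
    define s t where "s = \<alpha> + \<beta>" and "t = \<beta> / (\<alpha> + \<beta>)"
    have s: "s > 0" and t: "0 \<le> t" "t \<le> 1" and t': "1 - t = \<alpha> / s"
      using 3 by (auto simp: s_def t_def field_simps)
    have pt: "(u x + v x) ^ m \<le> s ^ m * ((1 - t) * (u x / \<alpha>) ^ m + t * (v x / \<beta>) ^ m)"
      if "x \<in> A" for x
    proof -
      have "((1 - t) *\<^sub>R (u x / \<alpha>) + t *\<^sub>R (v x / \<beta>)) ^ m
          \<le> (1 - t) * (u x / \<alpha>) ^ m + t * (v x / \<beta>) ^ m"
        using 3 assms(3,4)[OF that] t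
        by (intro convex_onD[OF convex_on_power_nonneg]) auto
      moreover have "u x + v x = s * ((1 - t) *\<^sub>R (u x / \<alpha>) + t *\<^sub>R (v x / \<beta>))"
        unfolding t' using 3 s by (simp add: t_def s_def[symmetric] field_simps)
      ultimately show ?thesis
        using s by (simp add: power_mult_distrib)
    qed
    have "(\<Sum>x\<in>A. (u x + v x) ^ m) \<le>
        (\<Sum>x\<in>A. s ^ m * ((1 - t) * (u x / \<alpha>) ^ m + t * (v x / \<beta>) ^ m))"
      by (intro sum_mono pt)
    also have "\<dots> = s ^ m * ((1 - t) * ((\<Sum>x\<in>A. u x ^ m) / \<alpha> ^ m) + t * ((\<Sum>x\<in>A. v x ^ m) / \<beta> ^ m))"
      by (simp add: sum.distrib sum_distrib_left[symmetric] sum_divide_distrib[symmetric] power_divide)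
    also have "\<dots> \<le> s ^ m * ((1 - t) * K + t * K)"
      using 3 s t u v by (intro mult_left_mono add_mono) (auto simp: field_simps)
    finally show ?thesis by (simp add: s_def algebra_simps)
  qed
qed

section \<open>The two-point inequality and its tensorization\<close>

lemma choose_Suc_real: "real (n choose Suc k) = real (n - k) / real (Suc k) * real (n choose k)"
proof -
  have "Suc k * (n choose Suc k) = (n - k) * (n choose k)"
  proof (cases "k \<le> n")
    case True
    then show ?thesis
      by (metis binomial_absorb_comp binomial_absorption binomial_eq_0_iff diff_is_0_eq le_eq_less_or_eq mult.commute mult_0 mult_0_right)
  qed (simp add: binomial_eq_0)
  then have "real (Suc k) * real (n choose Suc k) = real (n - k) * real (n choose k)"
    by (metis of_nat_mult)
  then show ?thesis by (simp add: field_simps)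
qed

text \<open>Induction through ratios of consecutive terms: the ratio on the left is
  \<open>(m - j) / (j + 1)\<close>, which is the ratio on the right, times
  \<open>q * (2 * m - 2 * j - 1) / (2 * j + 1)\<close>, which is at most
  \<open>q * (2 * m - 1)\<close>.\<close>

lemma choose_double_le:
  fixes q :: real
  assumes "q \<ge> 0" "q * (2 * real m - 1) \<le> 1" "j \<le> m"
  shows "real ((2 * m) choose (2 * j)) * q ^ j \<le> real (m choose j)"
  using assms(3)
proof (induction j)
  case 0
  then show ?case by simp
next
  case (Suc j)
  define R where "R = real ((2 * m) choose (2 * j))"
  have jm: "real j + 1 \<le> real m"
    using Suc.prems by linarith
  have "real ((2 * m) choose (2 * Suc j)) =
      (2 * real m - 2 * real j - 1) / (2 * real j + 2) * ((2 * real m - 2 * real j) / (2 * real j + 1) * R)"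
    using Suc.prems by (simp add: choose_Suc_real R_def of_nat_diff algebra_simps)
  also have "\<dots> = ((2 * real m - 2 * real j - 1) / (2 * real j + 1)) * ((real m - real j) / (real j + 1)) * R"
    by (simp add: divide_simps) (simp add: algebra_simps)
  finally have eq: "real ((2 * m) choose (2 * Suc j)) = \<dots>" .
  have "q * ((2 * real m - 2 * real j - 1) / (2 * real j + 1)) \<le> q * (2 * real m - 1)"
    using jm assms(1) by (intro mult_left_mono) (auto simp: field_simps)
  then have q1: "q * ((2 * real m - 2 * real j - 1) / (2 * real j + 1)) \<le> 1"
    using assms(2) by linarith
  have "real ((2 * m) choose (2 * Suc j)) * q ^ Suc j =
      (q * ((2 * real m - 2 * real j - 1) / (2 * real j + 1))) * ((real m - real j) / (real j + 1) * (R * q ^ j))"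
    unfolding eq by simp
  also have "\<dots> \<le> 1 * ((real m - real j) / (real j + 1) * (R * q ^ j))"
    using jm assms(1) by (intro mult_right_mono q1) (auto simp: R_def)
  also have "\<dots> \<le> (real m - real j) / (real j + 1) * real (m choose j)"
    unfolding mult_1 using jm Suc by (intro mult_left_mono) (auto simp: R_def)
  also have "\<dots> = real (m choose Suc j)"
    using Suc.prems by (simp add: choose_Suc_real of_nat_diff add.commute)
  finally show ?case .
qed

lemma sum_even_index:
  fixes g :: "nat \<Rightarrow> real"
  assumes "\<And>k. odd k \<Longrightarrow> g k = 0"
  shows "(\<Sum>k\<le>2 * m. g k) = (\<Sum>j\<le>m. g (2 * j))"
  by (induction m) (simp_all add: assms)

text \<open>Bonami's inequality in one coordinate. Odd powers cancel in the binomial expansion, and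
  the even ones are compared term by term with the expansion of the right-hand side.\<close>

lemma two_point_inequality:
  fixes u v r :: real
  assumes "r\<^sup>2 * (2 * real m - 1) \<le> 1"
  shows "(u + r * v) ^ (2 * m) + (u - r * v) ^ (2 * m) \<le> 2 * (u\<^sup>2 + v\<^sup>2) ^ m"
proof -
  define g where "g k = real (2 * m choose k) * ((r * v) ^ k + (- (r * v)) ^ k) * u ^ (2 * m - k)" for k
  have "(u + r * v) ^ (2 * m) + (u - r * v) ^ (2 * m) = (r * v + u) ^ (2 * m) + (- (r * v) + u) ^ (2 * m)"
    by (simp add: add.commute)
  also have "\<dots> = (\<Sum>k\<le>2 * m. g k)"
    by (simp only: binomial_ring g_def sum.distrib[symmetric] distrib_left distrib_right)
  also have "\<dots> = (\<Sum>j\<le>m. g (2 * j))"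
    by (rule sum_even_index) (simp add: g_def)
  also have "\<dots> \<le> (\<Sum>j\<le>m. 2 * (real (m choose j) * (v\<^sup>2) ^ j * (u\<^sup>2) ^ (m - j)))"
  proof (rule sum_mono)
    fix j assume j: "j \<in> {..m}"
    have "g (2 * j) = 2 * ((real ((2 * m) choose (2 * j)) * (r\<^sup>2) ^ j) * ((v\<^sup>2) ^ j * (u\<^sup>2) ^ (m - j)))"
      by (simp add: g_def power_mult power_mult_distrib power_even_eq flip: diff_mult_distrib2)
    also have "\<dots> \<le> 2 * (real (m choose j) * ((v\<^sup>2) ^ j * (u\<^sup>2) ^ (m - j)))"
      using assms j by (intro mult_left_mono mult_right_mono choose_double_le) auto
    finally show "g (2 * j) \<le> 2 * (real (m choose j) * (v\<^sup>2) ^ j * (u\<^sup>2) ^ (m - j))"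
      by (simp add: mult.assoc)
  qed
  also have "\<dots> = 2 * (u\<^sup>2 + v\<^sup>2) ^ m"
    by (simp add: binomial_ring[of "v\<^sup>2" "u\<^sup>2"] add.commute[of "u\<^sup>2"] sum_distrib_left)
  finally show ?thesis .
qed

text \<open>Splitting off coordinate \<open>k\<close> turns the function into
  \<open>u + r * v\<close> on one half of the cube and \<open>u - r * v\<close> on the other. The
  two-point inequality applies at each point, and Minkowski for \<open>u\<^sup>2\<close> and
  \<open>v\<^sup>2\<close> combines the two induction hypotheses.\<close>

lemma hypercontractive_walsh:
  fixes r :: real
  assumes "finite I" "m \<ge> 1" "r\<^sup>2 * (2 * real m - 1) \<le> 1"
  shows "(\<Sum>X\<in>Pow I. (\<Sum>S\<in>Pow I. r ^ card S * c S * walsh S X) ^ (2 * m))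
    \<le> 2 ^ card I * (\<Sum>S\<in>Pow I. (c S)\<^sup>2) ^ m"
  using assms(1)
proof (induction I arbitrary: c rule: finite_induct)
  case empty
  then show ?case by (simp add: walsh_def power_mult)
next
  case (insert k T)
  define u v where "u X = (\<Sum>S\<in>Pow T. r ^ card S * c S * walsh S X)"
    and "v X = (\<Sum>S\<in>Pow T. r ^ card S * c (insert k S) * walsh S X)" for X
  define \<alpha> \<beta> where "\<alpha> = (\<Sum>S\<in>Pow T. (c S)\<^sup>2)" and "\<beta> = (\<Sum>S\<in>Pow T. (c (insert k S))\<^sup>2)"
  let ?F = "\<lambda>X. \<Sum>S\<in>Pow (insert k T). r ^ card S * c S * walsh S X"
  have S: "k \<notin> S \<and> finite S" if "S \<in> Pow T" for S
    using that insert.hyps by (auto intro: finite_subset)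
  have F: "?F X = u X + r * v X" "?F (insert k X) = u X - r * v X" if "X \<in> Pow T" for X
    unfolding sum_Pow_insert[OF insert.hyps] u_def v_def sum_distrib_left
      sum.distrib[symmetric] sum_subtractf[symmetric]
    using S that by (auto intro!: sum.cong simp: walsh_insert_both)
  have "(\<Sum>X\<in>Pow (insert k T). ?F X ^ (2 * m)) =
      (\<Sum>X\<in>Pow T. (u X + r * v X) ^ (2 * m) + (u X - r * v X) ^ (2 * m))"
    unfolding sum_Pow_insert[OF insert.hyps, of "\<lambda>X. ?F X ^ (2 * m)"]
    by (intro sum.cong refl) (simp only: F)
  also have "\<dots> \<le> (\<Sum>X\<in>Pow T. 2 * ((u X)\<^sup>2 + (v X)\<^sup>2) ^ m)"
    by (intro sum_mono two_point_inequality assms)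
  also have "\<dots> = 2 * (\<Sum>X\<in>Pow T. ((u X)\<^sup>2 + (v X)\<^sup>2) ^ m)"
    by (simp add: sum_distrib_left)
  also have "\<dots> \<le> 2 * (2 ^ card T * (\<alpha> + \<beta>) ^ m)"
    using insert.IH[of c] insert.IH[of "\<lambda>S. c (insert k S)"] insert.hyps assms
    by (intro mult_left_mono minkowski_power_sum)
      (auto simp: \<alpha>_def \<beta>_def u_def v_def power_mult intro!: sum_nonneg)
  also have "\<dots> = 2 ^ card (insert k T) * (\<Sum>S\<in>Pow (insert k T). (c S)\<^sup>2) ^ m"
    using insert.hyps by (simp add: sum_Pow_insert \<alpha>_def \<beta>_def sum.distrib)
  finally show ?case .
qed

section \<open>The dual inequality\<close>

text \<open>Jensen's inequality for the uniform average; it serves as Hoelder's inequality against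
  the indicator of \<open>B\<close>.\<close>

lemma power_sum_le_card_mult:
  fixes y :: "'b \<Rightarrow> real"
  assumes "finite B" "\<And>x. x \<in> B \<Longrightarrow> y x \<ge> 0"
  shows "(\<Sum>x\<in>B. y x) ^ Suc k \<le> real (card B) ^ k * (\<Sum>x\<in>B. y x ^ Suc k)"
proof (cases "B = {}")
  case False
  define N where "N = real (card B)"
  have N: "N > 0"
    using False assms(1) by (simp add: N_def card_gt_0_iff)
  have "(\<Sum>x\<in>B. (1 / N) *\<^sub>R y x) ^ Suc k \<le> (\<Sum>x\<in>B. 1 / N * y x ^ Suc k)"
    by (rule convex_on_sum[OF assms(1) False convex_on_power_nonneg])
      (use assms N in \<open>auto simp: N_def\<close>)
  then have "((\<Sum>x\<in>B. y x) / N) ^ Suc k \<le> (\<Sum>x\<in>B. y x ^ Suc k) / N"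
    by (simp add: sum_divide_distrib)
  then have "(\<Sum>x\<in>B. y x) ^ Suc k \<le> (\<Sum>x\<in>B. y x ^ Suc k) / N * N ^ Suc k"
    using N by (simp only: power_divide pos_divide_le_eq zero_less_power)
  then show ?thesis
    using N by (simp add: N_def mult.commute)
qed simp

text \<open>With \<open>T\<close> the damping operator, the left sum \<open>W\<close> is the
  normalized pairing of \<open>g\<close> with \<open>h = T (T g)\<close>. Hoelder on the support of
  \<open>g\<close> and hypercontractivity for \<open>h\<close> give
  \<open>W ^ (2 * m) \<le> p ^ (2 * m - 1) * W ^ m\<close>, where \<open>p\<close> is the density of
  the support; then \<open>W ^ m\<close> cancels.\<close>

lemma hypercontractive_dual:
  fixes r :: real
  assumes "finite I" "m \<ge> 1" "r\<^sup>2 * (2 * real m - 1) \<le> 1"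
    and g: "\<And>X. X \<subseteq> I \<Longrightarrow> g X \<in> {-1, 0, 1}"
  shows "(\<Sum>S\<in>Pow I. (r ^ card S * fcoeff I g S)\<^sup>2) ^ m
    \<le> ((\<Sum>X\<in>Pow I. \<bar>g X\<bar>) / 2 ^ card I) ^ (2 * m - 1)"
proof -
  define W N B where "W = (\<Sum>S\<in>Pow I. (r ^ card S * fcoeff I g S)\<^sup>2)"
    and "N = (2 :: real) ^ card I" and "B = {X \<in> Pow I. g X \<noteq> 0}"
  define h where "h X = (\<Sum>S\<in>Pow I. r ^ card S * (r ^ card S * fcoeff I g S) * walsh S X)" for X
  have fin: "finite B" and N: "N > 0" and W: "W \<ge> 0"
    using assms(1) by (auto simp: B_def N_def W_def intro: sum_nonneg)
  obtain k where k: "2 * m = Suc k"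
    using \<open>m \<ge> 1\<close> by (cases "2 * m") auto
  have abs_g: "\<bar>g X\<bar> = (if g X \<noteq> 0 then 1 else 0)" if "X \<in> Pow I" for X
    using g[of X] that by auto
  have "real (card B) = (\<Sum>X\<in>Pow I. if g X \<noteq> 0 then 1 else 0)"
    unfolding B_def using assms(1) by (simp add: sum.inter_filter[symmetric])
  then have P: "(\<Sum>X\<in>Pow I. \<bar>g X\<bar>) = real (card B)"
    by (simp only: abs_g cong: sum.cong)
  have "(\<Sum>X\<in>Pow I. \<bar>h X\<bar> ^ Suc k) = (\<Sum>X\<in>Pow I. h X ^ (2 * m))"
    by (simp add: k[symmetric] power_even_abs del: power_Suc)
  also have "\<dots> \<le> N * W ^ m"
    unfolding h_def N_def W_def by (rule hypercontractive_walsh[OF assms(1-3)])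
  finally have H: "(\<Sum>X\<in>Pow I. \<bar>h X\<bar> ^ Suc k) \<le> N * W ^ m" .
  have "N * W = (\<Sum>X\<in>Pow I. g X * h X)"
    unfolding h_def sum_mult_walsh_expansion W_def N_def power2_eq_square by (simp add: mult_ac)
  also have "\<dots> \<le> (\<Sum>X\<in>Pow I. if X \<in> B then \<bar>h X\<bar> else 0)"
  proof (rule sum_mono)
    fix X assume "X \<in> Pow I"
    then show "g X * h X \<le> (if X \<in> B then \<bar>h X\<bar> else 0)"
      using g[of X] by (auto simp: B_def)
  qed
  also have "\<dots> = (\<Sum>X\<in>B. \<bar>h X\<bar>)"
    using assms(1) by (subst sum.inter_restrict[symmetric]) (auto simp: B_def intro: sum.cong)
  finally have "(N * W) ^ Suc k \<le> (\<Sum>X\<in>B. \<bar>h X\<bar>) ^ Suc k"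
    using N W by (intro power_mono) auto
  also have "\<dots> \<le> real (card B) ^ k * (\<Sum>X\<in>B. \<bar>h X\<bar> ^ Suc k)"
    by (rule power_sum_le_card_mult[OF fin]) simp
  also have "\<dots> \<le> real (card B) ^ k * (\<Sum>X\<in>Pow I. \<bar>h X\<bar> ^ Suc k)"
    using assms(1) by (intro mult_left_mono sum_mono2) (auto simp: B_def)
  also have "\<dots> \<le> real (card B) ^ k * (N * W ^ m)"
    using H by (intro mult_left_mono) auto
  also have "real (card B) ^ k * (N * W ^ m) = N ^ Suc k * ((real (card B) / N) ^ k * W ^ m)"
    using N by (simp add: power_divide)
  finally have "N ^ Suc k * W ^ Suc k \<le> N ^ Suc k * ((real (card B) / N) ^ k * W ^ m)"
    using N by (simp only: power_mult_distrib mult_left_mono)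
  then have *: "W ^ Suc k \<le> (real (card B) / N) ^ k * W ^ m"
    using N by (subst (asm) mult_le_cancel_left_pos) auto
  have "W ^ m \<le> (real (card B) / N) ^ k"
  proof (cases "W = 0")
    case True
    then show ?thesis
      using \<open>m \<ge> 1\<close> N by (simp add: power_0_left)
  next
    case False
    have "W ^ m * W ^ m \<le> (real (card B) / N) ^ k * W ^ m"
      using * unfolding k[symmetric] by (simp add: mult_2 power_add)
    then show ?thesis
      using False W by (subst (asm) mult_le_cancel_right_pos) auto
  qed
  then show ?thesis
    using k by (simp add: P W_def N_def)
qed

subsection \<open>Influences and damped Walsh weight\<close>

definition toggle :: "'a \<Rightarrow> 'a set \<Rightarrow> 'a set" where
  "toggle k X = (if k \<in> X then X - {k} else insert k X)"

lemma toggle_toggle [simp]: "toggle k (toggle k X) = X"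
  by (auto simp: toggle_def)

lemma toggle_subset: "k \<in> I \<Longrightarrow> X \<subseteq> I \<Longrightarrow> toggle k X \<subseteq> I"
  by (auto simp: toggle_def)

lemma walsh_toggle:
  assumes "finite S"
  shows "walsh S (toggle k X) = (if k \<in> S then -1 else 1) * walsh S X"
proof -
  have *: "walsh S (insert k Y) = (if k \<in> S then -1 else 1) * walsh S Y" if "k \<notin> Y" for Y
  proof (cases "k \<in> S")
    case True
    then obtain S' where S': "S = insert k S'" "k \<notin> S'"
      by (meson mk_disjoint_insert)
    then show ?thesis
      using that assms by (simp add: walsh_insert_both)
  qed simp
  show ?thesis
  proof (cases "k \<in> X")
    case True
    then have "walsh S X = (if k \<in> S then -1 else 1) * walsh S (X - {k})"
      using *[of "X - {k}"] by (simp add: insert_absorb)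
    then show ?thesis
      using True by (simp add: toggle_def)
  qed (simp add: * toggle_def)
qed

text \<open>Toggling \<open>k\<close> permutes the cube, negates the characters containing
  \<open>k\<close> and fixes the others.\<close>

lemma fcoeff_toggle_diff:
  assumes "finite I" "k \<in> I" "S \<subseteq> I"
  shows "fcoeff I (\<lambda>X. f (toggle k X) - f X) S = (if k \<in> S then -2 else 0) * fcoeff I f S"
proof -
  have S: "finite S"
    using assms by (auto intro: finite_subset)
  have "(\<Sum>X\<in>Pow I. f (toggle k X) * walsh S X) = (\<Sum>X\<in>Pow I. f X * walsh S (toggle k X))"
    using assms by (intro sum.reindex_bij_witness[of _ "toggle k" "toggle k"]) (auto dest: toggle_subset)
  also have "\<dots> = (if k \<in> S then -1 else 1) * (\<Sum>X\<in>Pow I. f X * walsh S X)"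
    by (simp add: walsh_toggle[OF S] sum_negf)
  finally show ?thesis
    by (simp add: fcoeff_def left_diff_distrib sum_subtractf diff_divide_distrib)
qed

section \<open>Hoelder's inequality through tangent lines\<close>

text \<open>The concave function \<open>x powr \<theta>\<close> lies below its tangent at
  \<open>t\<close>; this is Young's inequality rescaled. The bound is linear in \<open>x\<close>, so
  it can be summed with weights.\<close>

lemma powr_le_tangent:
  fixes x t \<theta> :: real
  assumes "x \<ge> 0" "t > 0" "0 < \<theta>" "\<theta> \<le> 1"
  shows "x powr \<theta> \<le> \<theta> * t powr (\<theta> - 1) * x + (1 - \<theta>) * t powr \<theta>"
proof (cases "x = 0")
  case False
  have "x powr \<theta> * t powr (1 - \<theta>) \<le> \<theta> * x + (1 - \<theta>) * t"
    using assms False by (intro Youngs_inequality_0) auto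
  then have "(x powr \<theta> * t powr (1 - \<theta>)) * t powr (\<theta> - 1) \<le> (\<theta> * x + (1 - \<theta>) * t) * t powr (\<theta> - 1)"
    by (rule mult_right_mono) simp
  also have "(x powr \<theta> * t powr (1 - \<theta>)) * t powr (\<theta> - 1) = x powr \<theta>"
    using assms by (simp add: mult.assoc powr_add[symmetric])
  also have "(\<theta> * x + (1 - \<theta>) * t) * t powr (\<theta> - 1) = \<theta> * t powr (\<theta> - 1) * x + (1 - \<theta>) * t powr \<theta>"
    using assms by (simp add: powr_diff field_simps)
  finally show ?thesis .
qed (use assms in simp)

text \<open>Hoelder's inequality in the form \<open>\<Sum> w x\<^bsup>\<theta>\<^esup> \<le> (\<Sum> w)\<^bsup>1 - \<theta>\<^esup> (\<Sum> w x)\<^bsup>\<theta>\<^esup>\<close>, with bounds in place of the two sums.\<close>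

lemma weighted_sum_powr_le:
  fixes w x :: "'b \<Rightarrow> real"
  assumes "\<And>i. i \<in> B \<Longrightarrow> w i \<ge> 0" "\<And>i. i \<in> B \<Longrightarrow> x i \<ge> 0" "t > 0" "0 < \<theta>" "\<theta> \<le> 1"
    and "(\<Sum>i\<in>B. w i) \<le> M" "(\<Sum>i\<in>B. w i * x i) \<le> M * t"
  shows "(\<Sum>i\<in>B. w i * x i powr \<theta>) \<le> M * t powr \<theta>"
proof -
  have "(\<Sum>i\<in>B. w i * x i powr \<theta>) \<le> (\<Sum>i\<in>B. w i * (\<theta> * t powr (\<theta> - 1) * x i + (1 - \<theta>) * t powr \<theta>))"
    using assms by (intro sum_mono mult_left_mono powr_le_tangent) auto
  also have "\<dots> = \<theta> * t powr (\<theta> - 1) * (\<Sum>i\<in>B. w i * x i) + (1 - \<theta>) * t powr \<theta> * (\<Sum>i\<in>B. w i)"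
    unfolding sum_distrib_left sum.distrib[symmetric]
    by (intro sum.cong refl) (simp add: algebra_simps)
  also have "\<dots> \<le> \<theta> * t powr (\<theta> - 1) * (M * t) + (1 - \<theta>) * t powr \<theta> * M"
    using assms by (intro add_mono mult_left_mono) auto
  also have "\<dots> = M * t powr \<theta>"
    using assms by (simp add: powr_diff field_simps)
  finally show ?thesis .
qed

text \<open>Every nonempty \<open>S\<close> contains some \<open>k\<close>, so its weight is
  dominated by the damped energies of the derivatives in the directions \<open>k\<close>. The dual
  inequality bounds each energy by a power of the influence.\<close>

lemma damped_weight_le_of_influences:
  fixes r a :: real
  assumes "finite I" "I \<noteq> {}" "m \<ge> 1" "r\<^sup>2 * (2 * real m - 1) \<le> 1"
    and f: "\<And>X. X \<subseteq> I \<Longrightarrow> f X \<in> {0, 1 :: real}"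
    and a: "0 < a" "a \<le> 1 / 2" "3 \<le> 2 * real m * a"
    and infl: "(\<Sum>k\<in>I. ((\<Sum>X\<in>Pow I. \<bar>f (toggle k X) - f X\<bar>) / 2 ^ card I)\<^sup>2) \<le> real (card I) powr - a"
  shows "(\<Sum>S\<in>Pow I - {{}}. (r ^ card S * fcoeff I f S)\<^sup>2) \<le> real (card I) powr - (a / 2)"
proof -
  define n where "n = real (card I)"
  define P where "P k = (\<Sum>X\<in>Pow I. \<bar>f (toggle k X) - f X\<bar>) / 2 ^ card I" for k
  define b where "b S = (r ^ card S * fcoeff I f S)\<^sup>2" for S
  \<comment> \<open>Chosen so that the \<open>m\<close>-th root of \<open>P k ^ (2 * m - 1)\<close>
    is \<open>((P k)\<^sup>2) powr \<theta>\<close>.\<close>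
  define \<theta> where "\<theta> = 1 - 1 / (2 * real m)"
  have n: "n \<ge> 1"
    using assms(1,2) by (simp add: n_def Suc_le_eq card_gt_0_iff)
  have \<theta>: "0 < \<theta>" "\<theta> \<le> 1"
    using \<open>m \<ge> 1\<close> by (auto simp: \<theta>_def field_simps)
  have P0: "P k \<ge> 0" for k
    by (simp add: P_def sum_nonneg)
  \<comment> \<open>The 4 is the square of the factor -2 in
    \<open>fcoeff_toggle_diff\<close>.\<close>
  have W: "(\<Sum>S\<in>Pow I. (if k \<in> S then 4 else 0) * b S) \<le> ((P k)\<^sup>2) powr \<theta>" (is "?W \<le> _") if k: "k \<in> I" for k
  proof -
    have W0: "?W \<ge> 0"
      by (intro sum_nonneg) (auto simp: b_def)
    have "?W = (\<Sum>S\<in>Pow I. (r ^ card S * fcoeff I (\<lambda>X. f (toggle k X) - f X) S)\<^sup>2)"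
      using assms(1) k
      by (intro sum.cong refl) (auto simp: fcoeff_toggle_diff b_def power_mult_distrib)
    moreover have "f (toggle k X) - f X \<in> {-1, 0, 1}" if "X \<subseteq> I" for X
      using f[OF that] f[OF toggle_subset[OF k that]] by auto
    then have "(\<Sum>S\<in>Pow I. (r ^ card S * fcoeff I (\<lambda>X. f (toggle k X) - f X) S)\<^sup>2) ^ m
        \<le> P k ^ (2 * m - 1)"
      unfolding P_def by (rule hypercontractive_dual[OF assms(1,3,4)])
    ultimately have Wm: "?W ^ m \<le> P k ^ (2 * m - 1)"
      by simp
    also have "P k ^ (2 * m - 1) = (((P k)\<^sup>2) powr \<theta>) ^ m"
    proof (cases "P k = 0")
      case False
      then have "P k > 0" using P0[of k] by simp
      then have "(((P k)\<^sup>2) powr \<theta>) ^ m = P k powr (2 * \<theta> * real m)"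
        by (simp add: powr_powr powr_realpow[symmetric] powr_numeral[symmetric] del: powr_numeral)
      also have "2 * \<theta> * real m = real (2 * m - 1)"
        using \<open>m \<ge> 1\<close> by (simp add: \<theta>_def field_simps of_nat_diff)
      finally show ?thesis
        using \<open>P k > 0\<close> by (simp add: powr_realpow)
    qed (use \<open>m \<ge> 1\<close> in \<open>simp add: power_0_left\<close>)
    finally show ?thesis
      using \<open>m \<ge> 1\<close> W0 by (subst (asm) power_mono_iff) auto
  qed
  have "(\<Sum>S\<in>Pow I - {{}}. b S) \<le> (\<Sum>S\<in>Pow I - {{}}. (\<Sum>k\<in>I. (if k \<in> S then 4 else 0) * b S))"
  proof (rule sum_mono)
    fix S assume S: "S \<in> Pow I - {{}}"
    then obtain k where "k \<in> S" "k \<in> I" by auto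
    then have "(if k \<in> S then 4 else 0) * b S \<le> (\<Sum>k\<in>I. (if k \<in> S then 4 else 0) * b S)"
      using assms(1) by (intro member_le_sum) (auto simp: b_def)
    moreover have "b S \<ge> 0" by (simp add: b_def)
    ultimately show "b S \<le> (\<Sum>k\<in>I. (if k \<in> S then 4 else 0) * b S)"
      using \<open>k \<in> S\<close> by simp
  qed
  also have "\<dots> \<le> (\<Sum>S\<in>Pow I. (\<Sum>k\<in>I. (if k \<in> S then 4 else 0) * b S))"
    using assms(1) by (intro sum_mono2) (auto simp: b_def intro!: sum_nonneg)
  also have "\<dots> = (\<Sum>k\<in>I. (\<Sum>S\<in>Pow I. (if k \<in> S then 4 else 0) * b S))"
    by (rule sum.swap)
  also have "\<dots> \<le> (\<Sum>k\<in>I. 1 * ((P k)\<^sup>2) powr \<theta>)"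
    using W by (intro sum_mono) auto
  \<comment> \<open>Hoelder with unit weights: total mass \<open>n\<close>, and mean of the squared
    influences at most \<open>n powr (- a) / n\<close>.\<close>
  also have "\<dots> \<le> n * (n powr (- a - 1)) powr \<theta>"
    using infl n \<theta>
    by (intro weighted_sum_powr_le) (auto simp: P_def n_def powr_diff powr_minus field_simps)
  also have "\<dots> = n powr (1 + (- a - 1) * \<theta>)"
    using n by (simp add: powr_powr powr_add)
  also have "\<dots> \<le> n powr (- (a / 2))"
  proof (rule powr_mono[OF _ n])
    \<comment> \<open>The loss from \<open>\<theta> < 1\<close> is at most half of the exponent
      \<open>a\<close>, because \<open>1 + a \<le> 3 / 2\<close> and
      \<open>3 \<le> 2 * m * a\<close>.\<close>
    have "(1 + a) / (2 * real m) \<le> a / 2"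
      using a \<open>m \<ge> 1\<close> by (simp add: field_simps)
    moreover have "1 + (- a - 1) * \<theta> = - a + (1 + a) / (2 * real m)"
      using \<open>m \<ge> 1\<close> by (simp add: \<theta>_def field_simps)
    ultimately show "1 + (- a - 1) * \<theta> \<le> - (a / 2)"
      by linarith
  qed
  finally show ?thesis
    by (simp add: b_def n_def)
qed

text \<open>Since \<open>\<rho> = r powr \<theta>\<close>, Hoelder with the squared coefficients as
  weights interpolates between dampings \<open>1\<close> and \<open>r\<close>. Parseval bounds the
  total weight by 1, and \<open>r \<le> \<rho>\<close> ensures
  \<open>\<theta> \<le> 1\<close>.\<close>

lemma damped_weight_interpolation:
  fixes r \<rho> t :: real
  assumes "finite I" and f: "\<And>X. X \<subseteq> I \<Longrightarrow> \<bar>f X\<bar> \<le> (1 :: real)"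
    and "0 < r" "r \<le> \<rho>" "\<rho> < 1" "t > 0"
    and "(\<Sum>S\<in>Pow I - {{}}. (r ^ card S * fcoeff I f S)\<^sup>2) \<le> t"
  shows "(\<Sum>S\<in>Pow I - {{}}. (\<rho> ^ card S * fcoeff I f S)\<^sup>2) \<le> t powr (ln \<rho> / ln r)"
proof -
  define \<theta> where "\<theta> = ln \<rho> / ln r"
  have ln: "ln r < 0" "ln \<rho> < 0" "ln r \<le> ln \<rho>"
    using assms by auto
  then have \<theta>: "0 < \<theta>" "\<theta> \<le> 1"
    by (auto simp: \<theta>_def divide_neg_neg)
  have \<rho>: "\<rho> = r powr \<theta>"
    using assms ln by (simp add: powr_def \<theta>_def)
  have pw: "(\<rho> ^ j)\<^sup>2 = ((r ^ j)\<^sup>2) powr \<theta>" for j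
  proof -
    have "(\<rho> ^ j)\<^sup>2 = \<rho> powr real (j * 2)"
      using assms by (simp only: powr_realpow power_mult less_le_trans)
    also have "\<dots> = (r powr real (j * 2)) powr \<theta>"
      unfolding \<rho> powr_powr by (simp only: mult.commute)
    also have "r powr real (j * 2) = (r ^ j)\<^sup>2"
      using assms by (simp only: powr_realpow power_mult)
    finally show ?thesis .
  qed
  have "(\<Sum>X\<in>Pow I. (f X)\<^sup>2) \<le> (\<Sum>X\<in>Pow I. 1)"
    using f by (intro sum_mono) (auto simp: abs_square_le_1)
  then have "(\<Sum>S\<in>Pow I. (fcoeff I f S)\<^sup>2) \<le> 1"
    using parseval[OF assms(1), of f] assms(1) by (simp add: card_Pow)
  moreover have "(\<Sum>S\<in>Pow I - {{}}. (fcoeff I f S)\<^sup>2) \<le> (\<Sum>S\<in>Pow I. (fcoeff I f S)\<^sup>2)"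
    using assms(1) by (intro sum_mono2) auto
  ultimately have "(\<Sum>S\<in>Pow I - {{}}. (fcoeff I f S)\<^sup>2) \<le> 1"
    by (rule order_trans[rotated])
  moreover have "(\<Sum>S\<in>Pow I - {{}}. (fcoeff I f S)\<^sup>2 * (r ^ card S)\<^sup>2) \<le> 1 * t"
    using assms(7) by (simp only: power_mult_distrib mult.commute mult_1)
  ultimately have "(\<Sum>S\<in>Pow I - {{}}. (fcoeff I f S)\<^sup>2 * ((r ^ card S)\<^sup>2) powr \<theta>) \<le> 1 * t powr \<theta>"
    using assms(6) \<theta> by (intro weighted_sum_powr_le) auto
  moreover have "(\<rho> ^ card S * fcoeff I f S)\<^sup>2 = (fcoeff I f S)\<^sup>2 * ((r ^ card S)\<^sup>2) powr \<theta>" for S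
    by (simp only: power_mult_distrib pw mult.commute)
  ultimately show ?thesis
    by (simp only: \<theta>_def mult_1)
qed

subsection \<open>Noise on the cube\<close>

text \<open>Translates between the set encoding used for Walsh analysis and the Boolean functions
  making up \<open>cube\<close>.\<close>

definition point :: "nat set \<Rightarrow> nat \<Rightarrow> bool" where
  "point X = (\<lambda>j. j \<in> X)"

lemma point_toggle: "flip k (point X) = point (toggle k X)"
  by (auto simp: flip_def point_def toggle_def fun_eq_iff)

lemma bij_betw_point: "bij_betw point (Pow {1..n}) (cube n)"
  unfolding bij_betw_def
proof
  show "inj_on point (Pow {1..n})"
    by (auto simp: inj_on_def point_def fun_eq_iff)
  show "point ` Pow {1..n} = cube n"
  proof (intro equalityI subsetI)
    fix y assume y: "y \<in> cube n"
    then have "{j. y j} \<in> Pow {1..n}"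
      by (auto simp: cube_def PiE_dflt_def)
    moreover have "y = point {j. y j}"
      by (simp add: point_def)
    ultimately show "y \<in> point ` Pow {1..n}"
      by blast
  qed (auto simp: cube_def PiE_dflt_def point_def)
qed

lemma finite_cube [simp]: "finite (cube n)"
  using bij_betw_finite[OF bij_betw_point] by simp

lemma cube_nonempty [simp]: "cube n \<noteq> {}"
  using bij_betw_imp_surj_on[OF bij_betw_point, of n] by blast

lemma card_cube: "card (cube n) = 2 ^ n"
  using bij_betw_same_card[OF bij_betw_point, of n] by (simp add: card_Pow)

lemma expectation_unif:
  fixes h :: "(nat \<Rightarrow> bool) \<Rightarrow> real"
  shows "measure_pmf.expectation (unif n) h = (\<Sum>X\<in>Pow {1..n}. h (point X)) / 2 ^ n"
  using sum.reindex_bij_betw[OF bij_betw_point, of h n]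
  by (simp add: unif_def integral_pmf_of_set card_cube)

lemma prob_eq_expectation_indicat:
  "measure_pmf.prob p A = measure_pmf.expectation p (indicat_real A)"
  by simp

text \<open>Subtracting the mean of the event therefore removes exactly the empty-set term from the
  noise expansion.\<close>

lemma prob_unif_eq_fcoeff_empty:
  "measure_pmf.prob (unif n) A = fcoeff {1..n} (\<lambda>X. indicat_real A (point X)) {}"
  unfolding prob_eq_expectation_indicat expectation_unif by (simp add: fcoeff_def walsh_def)

lemma II_eq_toggle:
  "II n f = (\<Sum>k\<in>{1..n}. ((\<Sum>X\<in>Pow {1..n}. \<bar>f (point (toggle k X)) - f (point X)\<bar>) / 2 ^ n)\<^sup>2)"
  by (simp add: II_def influence_def expectation_unif point_toggle)

lemma walsh_eq_prod:
  assumes "finite S"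
  shows "walsh S X = (\<Prod>j\<in>S. if j \<in> X then -1 else 1)"
  using assms by (simp add: walsh_def prod.If_cases)

lemma set_pmf_noise_subset: "set_pmf (noise n \<epsilon> x) \<subseteq> cube n"
  using set_Pi_pmf_subset'[of "{1..n}"] by (force simp: noise_def cube_def PiE_dflt_def)

lemma finite_set_pmf_noise: "finite (set_pmf (noise n \<epsilon> x))"
  by (rule finite_subset[OF set_pmf_noise_subset]) simp

lemma noise_component:
  "j \<in> {1..n} \<Longrightarrow> map_pmf (\<lambda>y. y j) (noise n \<epsilon> x) = map_pmf (\<lambda>b. if b then \<not> x j else x j) (bernoulli_pmf \<epsilon>)"
  by (simp add: noise_def Pi_pmf_component)

text \<open>A character is a product of coordinate signs, which are independent under the noise;
  each sign has its mean scaled by \<open>1 - 2 * \<epsilon>\<close>.\<close>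

lemma expectation_walsh_noise:
  assumes "S \<subseteq> {1..n}" "0 \<le> \<epsilon>" "\<epsilon> \<le> 1"
  shows "measure_pmf.expectation (noise n \<epsilon> (point X)) (\<lambda>y. walsh S {j. y j}) = (1 - 2 * \<epsilon>) ^ card S * walsh S X"
proof -
  let ?p = "noise n \<epsilon> (point X)"
  define s where "s b = (if b then -1 else 1 :: real)" for b
  have fin: "finite S"
    using assms by (auto intro: finite_subset)
  have "prob_space.indep_vars ?p (\<lambda>_. count_space UNIV) (\<lambda>j y. y j) {1..n}"
    unfolding noise_def by (rule indep_vars_Pi_pmf) simp
  then have "prob_space.indep_vars ?p (\<lambda>_. count_space UNIV) (\<lambda>j y. y j) S"
    using assms(1) by (rule prob_space.indep_vars_subset[OF measure_pmf.prob_space_axioms])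
  then have ind: "prob_space.indep_vars ?p (\<lambda>_. borel) (\<lambda>j y. s (y j)) S"
    by (rule prob_space.indep_vars_compose2[OF measure_pmf.prob_space_axioms]) simp
  have "measure_pmf.expectation ?p (\<lambda>y. walsh S {j. y j}) =
      measure_pmf.expectation ?p (\<lambda>y. \<Prod>j\<in>S. s (y j))"
    by (simp add: walsh_eq_prod[OF fin] s_def)
  also have "\<dots> = (\<Prod>j\<in>S. measure_pmf.expectation ?p (\<lambda>y. s (y j)))"
    by (rule prob_space.indep_vars_lebesgue_integral[OF measure_pmf.prob_space_axioms fin ind])
      (rule integrable_measure_pmf_finite[OF finite_set_pmf_noise])
  also have "\<dots> = (\<Prod>j\<in>S. (1 - 2 * \<epsilon>) * s (j \<in> X))"
  proof (rule prod.cong[OF refl])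
    fix j assume j: "j \<in> S"
    have "measure_pmf.expectation ?p (\<lambda>y. s (y j)) =
        measure_pmf.expectation (map_pmf (\<lambda>y. y j) ?p) s"
      by simp
    also have "map_pmf (\<lambda>y. y j) ?p = map_pmf (\<lambda>b. if b then j \<notin> X else j \<in> X) (bernoulli_pmf \<epsilon>)"
      using j assms(1) by (subst noise_component) (auto simp: point_def)
    also have "measure_pmf.expectation \<dots> s = (1 - 2 * \<epsilon>) * s (j \<in> X)"
      using assms by (simp add: s_def)
    finally show "measure_pmf.expectation ?p (\<lambda>y. s (y j)) = (1 - 2 * \<epsilon>) * s (j \<in> X)" .
  qed
  also have "\<dots> = (1 - 2 * \<epsilon>) ^ card S * walsh S X"
    by (simp add: prod.distrib walsh_eq_prod[OF fin] s_def)
  finally show ?thesis .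
qed

lemma prob_noise_expansion:
  assumes "0 \<le> \<epsilon>" "\<epsilon> \<le> 1"
  shows "measure_pmf.prob (noise n \<epsilon> (point X)) A =
    (\<Sum>S\<in>Pow {1..n}. (1 - 2 * \<epsilon>) ^ card S * fcoeff {1..n} (\<lambda>X. indicat_real A (point X)) S * walsh S X)"
proof -
  let ?p = "noise n \<epsilon> (point X)" and ?c = "fcoeff {1..n} (\<lambda>X. indicat_real A (point X))"
  \<comment> \<open>Inversion is valid only at subsets of \<open>{1..n}\<close>, hence the
    restriction to the support of the noise.\<close>
  have "indicat_real A y = (\<Sum>S\<in>Pow {1..n}. ?c S * walsh S {j. y j})" if "y \<in> set_pmf ?p" for y
  proof -
    have "{j. y j} \<subseteq> {1..n}"
      using that set_pmf_noise_subset by (force simp: cube_def PiE_dflt_def)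
    then show ?thesis
      using walsh_inversion[of "{1..n}" "{j. y j}" "\<lambda>X. indicat_real A (point X)"]
      by (simp add: point_def)
  qed
  then have "measure_pmf.prob ?p A =
      measure_pmf.expectation ?p (\<lambda>y. \<Sum>S\<in>Pow {1..n}. ?c S * walsh S {j. y j})"
    unfolding prob_eq_expectation_indicat
    by (intro integral_cong_AE) (auto simp: AE_measure_pmf_iff)
  also have "\<dots> = (\<Sum>S\<in>Pow {1..n}. ?c S * measure_pmf.expectation ?p (\<lambda>y. walsh S {j. y j}))"
    by (subst Bochner_Integration.integral_sum)
      (auto intro!: integrable_measure_pmf_finite finite_set_pmf_noise)
  also have "\<dots> = (\<Sum>S\<in>Pow {1..n}. (1 - 2 * \<epsilon>) ^ card S * ?c S * walsh S X)"
    using assms by (intro sum.cong refl) (simp add: expectation_walsh_noise)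
  finally show ?thesis .
qed

text \<open>Chebyshev's inequality, with the second moment computed by Parseval.\<close>

lemma sens_gamma_le:
  assumes "0 \<le> \<epsilon>" "\<epsilon> \<le> 1" "\<delta> > 0"
  shows "sens_gamma n A \<epsilon> \<delta> * \<delta>\<^sup>2 \<le>
    (\<Sum>S\<in>Pow {1..n} - {{}}. ((1 - 2 * \<epsilon>) ^ card S * fcoeff {1..n} (\<lambda>X. indicat_real A (point X)) S)\<^sup>2)"
proof -
  let ?c = "\<lambda>S. (1 - 2 * \<epsilon>) ^ card S * fcoeff {1..n} (\<lambda>X. indicat_real A (point X)) S"
  let ?d = "\<lambda>x. measure_pmf.prob (noise n \<epsilon> x) A - measure_pmf.prob (unif n) A"
  let ?B = "{x \<in> cube n. \<bar>?d x\<bar> > \<delta>}"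
  define c' where "c' S = (if S = {} then 0 else ?c S)" for S
  have remove: "(\<Sum>S\<in>Pow {1..n}. h S) = h {} + (\<Sum>S\<in>Pow {1..n} - {{}}. h S)" for h :: "nat set \<Rightarrow> real"
    by (rule sum.remove) auto
  have d: "?d (point X) = (\<Sum>S\<in>Pow {1..n}. c' S * walsh S X)" for X
    unfolding prob_noise_expansion[OF assms(1,2)] prob_unif_eq_fcoeff_empty remove
    by (simp add: c'_def walsh_def)
  have "sens_gamma n A \<epsilon> \<delta> * \<delta>\<^sup>2 = (\<Sum>X\<in>Pow {1..n}. indicat_real ?B (point X) * \<delta>\<^sup>2) / 2 ^ n"
    unfolding sens_gamma_def prob_eq_expectation_indicat expectation_unif
    by (simp add: sum_distrib_right)
  also have "\<dots> \<le> (\<Sum>X\<in>Pow {1..n}. (?d (point X))\<^sup>2) / 2 ^ n"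
  proof (intro divide_right_mono sum_mono)
    fix X
    have "\<bar>?d (point X)\<bar> > \<delta> \<Longrightarrow> \<delta>\<^sup>2 \<le> (?d (point X))\<^sup>2"
      using assms(3) by (simp add: abs_le_square_iff[symmetric])
    then show "indicat_real ?B (point X) * \<delta>\<^sup>2 \<le> (?d (point X))\<^sup>2"
      by (auto simp: indicator_def)
  qed simp
  also have "\<dots> = (\<Sum>S\<in>Pow {1..n}. (c' S)\<^sup>2)"
    unfolding d by (subst walsh_parseval) auto
  also have "\<dots> = (\<Sum>S\<in>Pow {1..n} - {{}}. (?c S)\<^sup>2)"
    unfolding remove by (simp add: c'_def)
  finally show ?thesis .
qed

section \<open>From second moments to the sensitivity gauge\<close>

lemma sens_phi_le:
  assumes "\<delta> > 0" "sens_gamma n A \<epsilon> \<delta> < \<delta>"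
  shows "sens_phi n A \<epsilon> \<le> \<delta>"
  unfolding sens_phi_def using assms by (intro cInf_lower) (auto intro!: bdd_belowI[of _ 0])

lemma sens_phi_nonneg: "sens_phi n A \<epsilon> \<ge> 0"
  unfolding sens_phi_def
proof (rule cInf_greatest)
  \<comment> \<open>A probability never reaches 2, so the set under the infimum is nonempty.\<close>
  have "sens_gamma n A \<epsilon> 2 < 2"
    unfolding sens_gamma_def using measure_pmf.prob_le_1 by (rule le_less_trans) simp
  then show "{\<delta>. \<delta> > 0 \<and> sens_gamma n A \<epsilon> \<delta> < \<delta>} \<noteq> {}"
    by (auto intro!: exI[of _ 2])
qed auto

text \<open>Chebyshev at level \<open>\<delta>\<close> suffices once the second moment is below
  \<open>\<delta> ^ 3\<close>; taking \<open>\<delta> = 2 * u\<close> makes the inequality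
  strict.\<close>

lemma sens_phi_le_of_second_moment:
  assumes "0 \<le> \<epsilon>" "\<epsilon> \<le> 1" "u > 0"
    and "(\<Sum>S\<in>Pow {1..n} - {{}}. ((1 - 2 * \<epsilon>) ^ card S * fcoeff {1..n} (\<lambda>X. indicat_real A (point X)) S)\<^sup>2) \<le> u ^ 3"
  shows "sens_phi n A \<epsilon> \<le> 2 * u"
proof (rule sens_phi_le)
  have "sens_gamma n A \<epsilon> (2 * u) * (2 * u)\<^sup>2 \<le> u ^ 3"
    using sens_gamma_le[of \<epsilon> "2 * u" n A] assms by linarith
  also have "u ^ 3 < 2 * u * (2 * u)\<^sup>2"
    using \<open>u > 0\<close> by (simp add: power2_eq_square power3_eq_cube)
  finally show "sens_gamma n A \<epsilon> (2 * u) < 2 * u"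
    using \<open>u > 0\<close> by (subst (asm) mult_less_cancel_right_pos) auto
qed (use assms in simp)

lemma sens_phi_decay:
  fixes a :: real
  assumes "0 < a" "a \<le> 1 / 2"
  obtains c :: real where "c > 0"
    "\<And>n A \<epsilon>. n \<ge> 1 \<Longrightarrow> II n (indicat_real A) \<le> real n powr - a \<Longrightarrow> 0 < \<epsilon> \<Longrightarrow> \<epsilon> < 1 / 4 \<Longrightarrow>
       sens_phi n A \<epsilon> \<le> 2 * real n powr - (c * \<epsilon>)"
proof -
  obtain m :: nat where m: "3 / (2 * a) \<le> real m"
    using real_arch_simple by blast
  then have ma: "3 \<le> 2 * real m * a"
    using assms by (simp add: field_simps)
  \<comment> \<open>\<open>m \<ge> 3\<close> forces \<open>r \<le> 1 / 2\<close>, which lies below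
    \<open>1 - 2 * \<epsilon>\<close> for every \<open>\<epsilon> < 1 / 4\<close>, as interpolation
    requires.\<close>
  have "3 \<le> 3 / (2 * a)"
    using assms by (simp add: field_simps)
  then have m3: "m \<ge> 3"
    using m by linarith
  define r where "r = 1 / sqrt (2 * real m - 1)"
  have r2: "r\<^sup>2 * (2 * real m - 1) \<le> 1"
    using m3 by (simp add: r_def power_divide)
  have "2 \<le> sqrt (2 * real m - 1)"
    using m3 by (intro real_le_rsqrt) auto
  then have r: "0 < r" "r \<le> 1 / 2"
    using m3 by (auto simp: r_def divide_simps)
  define L where "L = - ln r"
  have L: "L > 0"
    using r by (simp add: L_def)
  \<comment> \<open>Interpolation gives the exponent \<open>- a * \<epsilon> / L\<close>; the 3
    comes from the cube root in the passage to the gauge.\<close>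
  define c where "c = a / (3 * L)"
  show ?thesis
  proof (rule that[of c])
    show "c > 0"
      using assms L by (simp add: c_def)
  next
    fix n A and \<epsilon> :: real
    assume n: "n \<ge> 1" and infl: "II n (indicat_real A) \<le> real n powr - a" and \<epsilon>: "0 < \<epsilon>" "\<epsilon> < 1 / 4"
    let ?f = "\<lambda>X. indicat_real A (point X)"
    have "(\<Sum>S\<in>Pow {1..n} - {{}}. (r ^ card S * fcoeff {1..n} ?f S)\<^sup>2) \<le> real (card {1..n}) powr - (a / 2)"
      using n m3 r2 assms ma infl
      by (intro damped_weight_le_of_influences[where m = m]) (auto simp: II_eq_toggle indicator_def)
    then have "(\<Sum>S\<in>Pow {1..n} - {{}}. ((1 - 2 * \<epsilon>) ^ card S * fcoeff {1..n} ?f S)\<^sup>2)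
        \<le> (real n powr - (a / 2)) powr (ln (1 - 2 * \<epsilon>) / ln r)"
      using r \<epsilon> n by (intro damped_weight_interpolation) (auto simp: indicator_def)
    also have "\<dots> = real n powr (a / (2 * L) * ln (1 - 2 * \<epsilon>))"
      using L by (simp add: powr_powr L_def)
    also have "\<dots> \<le> real n powr (a / (2 * L) * (- 2 * \<epsilon>))"
      using ln_le_minus_one[of "1 - 2 * \<epsilon>"] \<epsilon> assms L n
      by (intro powr_mono mult_left_mono) auto
    also have "\<dots> = (real n powr - (c * \<epsilon>)) ^ 3"
      using n by (simp add: powr_realpow[symmetric] powr_powr c_def powr_numeral[symmetric] del: powr_numeral)
    finally show "sens_phi n A \<epsilon> \<le> 2 * real n powr - (c * \<epsilon>)"
      using \<epsilon> n by (intro sens_phi_le_of_second_moment) auto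
  qed
qed

theorem theorem1p5:
  fixes a :: real
  assumes "0 < a" and "a \<le> 1/2"
  shows
    "(\<exists>c1 c2 :: real. c1 > 0 \<and> c2 > 0 \<and>
        (\<forall>n::nat. n \<ge> 1 \<longrightarrow> (\<forall>A. A \<subseteq> cube n \<longrightarrow> II n (indicat_real A) \<le> real n powr (- a) \<longrightarrow>
          (\<forall>\<epsilon>::real. 0 < \<epsilon> \<and> \<epsilon> < 1/4 \<longrightarrow>
             sens_phi n A \<epsilon> \<le> c1 * real n powr (- (c2 * \<epsilon>)))))) \<and>
     (\<forall>(N :: nat \<Rightarrow> nat) (A :: nat \<Rightarrow> (nat \<Rightarrow> bool) set) (e :: nat \<Rightarrow> real).
        (\<forall>m. N m \<ge> 1 \<and> A m \<subseteq> cube (N m) \<and>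
             II (N m) (indicat_real (A m)) \<le> real (N m) powr (- a)) \<longrightarrow>
        (\<forall>m. 0 < e m \<and> e m < 1/4) \<longrightarrow>
        filterlim (\<lambda>m. e m * ln (real (N m))) at_top sequentially \<longrightarrow>
        (\<lambda>m. sens_phi (N m) (A m) (e m)) \<longlonglongrightarrow> 0)"
proof -
  obtain c where c: "c > 0"
    and phi: "\<And>n A \<epsilon>. n \<ge> 1 \<Longrightarrow> II n (indicat_real A) \<le> real n powr - a \<Longrightarrow> 0 < \<epsilon> \<Longrightarrow> \<epsilon> < 1 / 4 \<Longrightarrow>
       sens_phi n A \<epsilon> \<le> 2 * real n powr - (c * \<epsilon>)"
    using sens_phi_decay[OF assms] by blast
  show ?thesis
  proof (intro conjI allI impI)
    show "\<exists>c1 c2 :: real. c1 > 0 \<and> c2 > 0 \<and>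
        (\<forall>n::nat. n \<ge> 1 \<longrightarrow> (\<forall>A. A \<subseteq> cube n \<longrightarrow> II n (indicat_real A) \<le> real n powr (- a) \<longrightarrow>
          (\<forall>\<epsilon>::real. 0 < \<epsilon> \<and> \<epsilon> < 1/4 \<longrightarrow>
             sens_phi n A \<epsilon> \<le> c1 * real n powr (- (c2 * \<epsilon>)))))"
      using c phi by (intro exI[of _ 2] exI[of _ c]) auto
  next
    fix N :: "nat \<Rightarrow> nat" and A :: "nat \<Rightarrow> (nat \<Rightarrow> bool) set" and e :: "nat \<Rightarrow> real"
    assume N: "\<forall>m. N m \<ge> 1 \<and> A m \<subseteq> cube (N m) \<and> II (N m) (indicat_real (A m)) \<le> real (N m) powr (- a)"
      and e: "\<forall>m. 0 < e m \<and> e m < 1/4"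
      and lim: "filterlim (\<lambda>m. e m * ln (real (N m))) at_top sequentially"
    \<comment> \<open>Written as an exponential, the bound depends on \<open>m\<close> only through
      \<open>e m * ln (N m)\<close>, the quantity assumed to diverge.\<close>
    have bound: "sens_phi (N m) (A m) (e m) \<le> 2 * exp (- (c * (e m * ln (real (N m)))))" for m
    proof -
      have "N m \<ge> 1"
        using N by simp
      moreover have "sens_phi (N m) (A m) (e m) \<le> 2 * real (N m) powr - (c * e m)"
        using N e by (intro phi) auto
      ultimately show ?thesis
        by (simp add: powr_def mult.assoc)
    qed
    have "filterlim (\<lambda>m. c * (e m * ln (real (N m)))) at_top sequentially"
      by (rule filterlim_tendsto_pos_mult_at_top[OF tendsto_const c lim])
    then have "filterlim (\<lambda>m. - (c * (e m * ln (real (N m))))) at_bot sequentially"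
      by (simp add: filterlim_uminus_at_top)
    then have "(\<lambda>m. exp (- (c * (e m * ln (real (N m)))))) \<longlonglongrightarrow> 0"
      by (rule filterlim_compose[OF exp_at_bot])
    then have "(\<lambda>m. 2 * exp (- (c * (e m * ln (real (N m)))))) \<longlonglongrightarrow> 0"
      by (auto intro: tendsto_eq_intros)
    then show "(\<lambda>m. sens_phi (N m) (A m) (e m)) \<longlonglongrightarrow> 0"
      by (rule real_tendsto_sandwich[OF _ _ tendsto_const, rotated 2])
        (use bound sens_phi_nonneg in auto)
  qed
qed

end
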